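(* Let $X$ be a nonempty second-countable Hausdorff regular space, let $S$ be a proper dyadic subbase of $X$, and let $D$ be either $D_S$ or $\widehat{D}_S$. If $p\in L(D)$, $x\in X$, and $p$ is compatible with $\tilde{x}$ in $\mathbb{T}^\omega$, then $p\sqsupseteq\tilde{x}$. In particular, $\widetilde{X}\subseteq\min(L(D))$.
   Context: $\mathbb{T}=\{0,1,\bot\}$ is ordered by $\bot\sqsubseteq 0$, $\bot\sqsubseteq 1$, and $\mathbb{T}^\omega$ (infinite sequences over $\mathbb{T}$) carries the product order $\sqsubseteq$. Two elements $p,q\in\mathbb{T}^\omega$ are compatible in $\mathbb{T}^\omega$ if they have a common upper bound in $\mathbb{T}^\omega$. For $p\in\mathbb{T}^\omega$, $\mathrm{dom}(p)=\{k: p(k)\neq\bot\}$; $\mathbb{T}^*$ is the set of $p\in\mathbb{T}^\omega$ with $\mathrm{dom}(p)$ finite. For $m\in\mathbb{N}$, $p|_m\in\mathbb{T}^*$ is defined by $p|_m(k)=p(k)$ if $k<m$ and $p|_m(k)=\bot$ if $k\ge m$. A dyadic subbase of $X$ is a family $S=\{S_{n,a}: n\in\mathbb{N}, a\in\{0,1\}\}$ of regular open sets (open sets equal to the interior of their closure) that forms a subbase of $X$ and such that $S_{n,1}$ is the exterior (complement of the closure) of $S_{n,0}$ for each $n$. Put $S_{n,\bot}=X\setminus(S_{n,0}\cup S_{n,1})$. For $x\in X$, $\tilde{x}\in\mathbb{T}^\omega$ is given by $\tilde{x}(n)=c$ iff $x\in S_{n,c}$ ($c\in\mathbb{T}$),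 and $\widetilde{X}=\{\tilde{x}:x\in X\}$. For $p\in\mathbb{T}^\omega$, $S(p)=\bigcap_{k\in\mathrm{dom}(p)}S_{k,p(k)}$ and $\bar{S}(p)=\bigcap_{k\in\mathrm{dom}(p)}\mathrm{cl}\,S_{k,p(k)}$ (empty intersection is $X$). $S$ is proper if $\mathrm{cl}\,S(e)=\bar{S}(e)$ for every $e\in\mathbb{T}^*$. Let $\uparrow\widetilde{X}=\{p\in\mathbb{T}^\omega: p\sqsupseteq\tilde{x}\text{ for some }x\in X\}$. Define the posets $K_S=\{p|_m:p\in\widetilde{X},m\in\mathbb{N}\}$ and $\widehat{K}_S=\{p|_m:p\in\uparrow\widetilde{X},m\in\mathbb{N}\}$ (subsets of $\mathbb{T}^*$), and let $D_S=\mathrm{Idl}(K_S)$, $\widehat{D}_S=\mathrm{Idl}(\widehat{K}_S)$ be their ideal completions (ideals, i.e. directed downwards-closed subsets, ordered by inclusion). Via $I\mapsto\bigsqcup I$ (supremum in $\mathbb{T}^\omega$) they are regarded as subposets of $\mathbb{T}^\omega$; the sets of compact elements are $K_S$ and $\widehat{K}_S$. For a domain (an $\omega$-algebraic pointed dcpo) $D$, $L(D)$ denotes the set of non-compact elements. For a poset $P$, $\min(P)$ is the set of minimal elements of $P$. *)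

theory Defs
  imports "HOL-Analysis.Analysis"
begin

text \<open>
  The set $\{0,1,\bot\}$ is modelled by \<^typ>\<open>bool option\<close>: \<^term>\<open>None\<close> is $\bot$,
  \<^term>\<open>Some False\<close> is the digit 0 and \<^term>\<open>Some True\<close> is the digit 1.  A sequence over
  this set is then a partial map from \<^typ>\<open>nat\<close> to \<^typ>\<open>bool\<close>; \<^term>\<open>dom p\<close> is
  the set of positions with a digit, the product order is \<^const>\<open>map_le\<close> (see
  \<open>map_le_iff_pointwise\<close>), and the truncation of \<open>p\<close> to its first \<open>m\<close> entries is
  \<open>p |` {..<m}\<close>.
\<close>

type_synonym tseq = "nat \<Rightarrow> bool option"

lemma map_le_iff_pointwise: "(p :: tseq) \<subseteq>\<^sub>m q \<longleftrightarrow> (\<forall>k. p k = None \<or> p k = q k)"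
  unfolding map_le_def Ball_def domIff imp_conv_disj not_not ..

lemma map_le_iff_Some: "(p :: tseq) \<subseteq>\<^sub>m q \<longleftrightarrow> (\<forall>k u. p k = Some u \<longrightarrow> q k = Some u)"
  unfolding map_le_iff_pointwise
proof (rule iff_allI)
  show "(p k = None \<or> p k = q k) \<longleftrightarrow> (\<forall>u. p k = Some u \<longrightarrow> q k = Some u)" for k
    by (cases "p k") auto
qed

definition compatible :: "tseq \<Rightarrow> tseq \<Rightarrow> bool" where
  "compatible p q \<longleftrightarrow> (\<exists>r. p \<subseteq>\<^sub>m r \<and> q \<subseteq>\<^sub>m r)"


section \<open>Subposets of the set of sequences\<close>

text \<open>Every poset below is a set \<open>P\<close> of sequences with the order induced by \<^const>\<open>map_le\<close>.\<close>

definition directed_set :: "tseq set \<Rightarrow> bool" where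
  "directed_set A \<longleftrightarrow> A \<noteq> {} \<and> (\<forall>a\<in>A. \<forall>b\<in>A. \<exists>c\<in>A. a \<subseteq>\<^sub>m c \<and> b \<subseteq>\<^sub>m c)"

definition is_lub_in :: "tseq set \<Rightarrow> tseq set \<Rightarrow> tseq \<Rightarrow> bool" where
  "is_lub_in P A s \<longleftrightarrow> s \<in> P \<and> (\<forall>a\<in>A. a \<subseteq>\<^sub>m s) \<and> (\<forall>t\<in>P. (\<forall>a\<in>A. a \<subseteq>\<^sub>m t) \<longrightarrow> s \<subseteq>\<^sub>m t)"

definition compact_elements :: "tseq set \<Rightarrow> tseq set" where
  "compact_elements P = {c \<in> P. \<forall>A s. A \<subseteq> P \<longrightarrow> directed_set A \<longrightarrow> is_lub_in P A s \<longrightarrow>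
     c \<subseteq>\<^sub>m s \<longrightarrow> (\<exists>a\<in>A. c \<subseteq>\<^sub>m a)}"

definition noncompact_elements :: "tseq set \<Rightarrow> tseq set" where
  "noncompact_elements P = P - compact_elements P"

definition minimal_elements :: "tseq set \<Rightarrow> tseq set" where
  "minimal_elements P = {p \<in> P. \<forall>q\<in>P. q \<subseteq>\<^sub>m p \<longrightarrow> q = p}"

definition ideals :: "tseq set \<Rightarrow> tseq set set" where
  "ideals K = {I. I \<subseteq> K \<and> directed_set I \<and> (\<forall>a\<in>I. \<forall>b\<in>K. b \<subseteq>\<^sub>m a \<longrightarrow> b \<in> I)}"

text \<open>
  The ideal completion of \<open>K\<close>, as the set of the suprema (taken among all sequences) of the
  ideals of \<open>K\<close>.  For a set \<open>K\<close> of sequences with finite domain this is isomorphic to the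
  set of ideals ordered by inclusion, by \<open>ideal_has_lub\<close> and \<open>ideal_lub_embedding\<close>.
\<close>

definition ideal_completion :: "tseq set \<Rightarrow> tseq set" where
  "ideal_completion K = {p. \<exists>I\<in>ideals K. is_lub_in UNIV I p}"

lemma directed_value_unique:
  assumes "directed_set A" "a \<in> A" "b \<in> A" "a k = Some u" "b k = Some v"
  shows "u = v"
proof -
  obtain c where "a \<subseteq>\<^sub>m c" "b \<subseteq>\<^sub>m c"
    using assms(1-3) unfolding directed_set_def by blast
  then have "c k = Some u" "c k = Some v"
    using assms(4,5) unfolding map_le_iff_Some by blast+
  then show ?thesis
    by simp
qed

lemma directed_has_lub:
  assumes A: "directed_set A"
  obtains s where "is_lub_in UNIV A s" "\<And>k u. s k = Some u \<longleftrightarrow> (\<exists>a\<in>A. a k = Some u)"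
proof -
  define s :: tseq where
    "s = (\<lambda>k. if \<exists>a\<in>A. a k \<noteq> None then Some (SOME u. \<exists>a\<in>A. a k = Some u) else None)"
  have s: "s k = Some u \<longleftrightarrow> (\<exists>a\<in>A. a k = Some u)" for k u
  proof
    assume "s k = Some u"
    then have ex: "\<exists>a\<in>A. a k \<noteq> None" and u: "u = (SOME v. \<exists>a\<in>A. a k = Some v)"
      unfolding s_def by (auto split: if_splits)
    have "\<exists>v. \<exists>a\<in>A. a k = Some v"
      using ex by blast
    from someI_ex[OF this] show "\<exists>a\<in>A. a k = Some u"
      unfolding u .
  next
    assume "\<exists>a\<in>A. a k = Some u"
    then obtain a where a: "a \<in> A" "a k = Some u"
      by blast
    have "(SOME v. \<exists>a\<in>A. a k = Some v) = u"
    proof (rule some_equality)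
      show "\<exists>a\<in>A. a k = Some u"
        using a by blast
    next
      fix v
      assume "\<exists>b\<in>A. b k = Some v"
      then obtain b where b: "b \<in> A" "b k = Some v"
        by blast
      show "v = u"
        by (rule directed_value_unique[OF A b(1) a(1) b(2) a(2)])
    qed
    moreover have "\<exists>a\<in>A. a k \<noteq> None"
      using a by (intro bexI[of _ a]) simp_all
    ultimately show "s k = Some u"
      unfolding s_def by simp
  qed
  have "is_lub_in UNIV A s"
    unfolding is_lub_in_def map_le_iff_Some
  proof (intro conjI ballI allI impI UNIV_I)
    fix a k u
    assume "a \<in> A" "a k = Some u"
    then show "s k = Some u"
      using s by blast
  next
    fix t k u
    assume t: "\<forall>a\<in>A. \<forall>k u. a k = Some u \<longrightarrow> t k = Some u" and "s k = Some u"
    then obtain a where "a \<in> A" "a k = Some u"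
      using s by blast
    then show "t k = Some u"
      using t by blast
  qed
  from that[OF this s] show ?thesis .
qed

lemma finite_below_directed_lub:
  assumes A: "directed_set A" and s: "is_lub_in UNIV A s"
    and fin: "finite (dom e)" and le: "e \<subseteq>\<^sub>m s"
  shows "\<exists>a\<in>A. e \<subseteq>\<^sub>m a"
proof -
  obtain s' where s': "is_lub_in UNIV A s'" "\<And>k u. s' k = Some u \<longleftrightarrow> (\<exists>a\<in>A. a k = Some u)"
    using directed_has_lub[OF A] by blast
  have "s = s'"
    using s s'(1) unfolding is_lub_in_def by (intro map_le_antisym) auto
  then have val: "\<exists>a\<in>A. a k = Some u" if "e k = Some u" for k u
    using that le s'(2) \<open>s = s'\<close> unfolding map_le_iff_Some by fastforce
  have "\<exists>a\<in>A. \<forall>k\<in>F. \<forall>u. e k = Some u \<longrightarrow> a k = Some u" if "finite F" for F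
    using that
  proof (induction F)
    case empty
    then show ?case
      using A unfolding directed_set_def by auto
  next
    case (insert k F)
    then obtain a where a: "a \<in> A" "\<forall>j\<in>F. \<forall>u. e j = Some u \<longrightarrow> a j = Some u"
      by blast
    show ?case
    proof (cases "e k")
      case None
      then show ?thesis
        using a by auto
    next
      case (Some v)
      then obtain b where b: "b \<in> A" "b k = Some v"
        using val by blast
      obtain c where "c \<in> A" "a \<subseteq>\<^sub>m c" "b \<subseteq>\<^sub>m c"
        using A a(1) b(1) unfolding directed_set_def by blast
      then show ?thesis
        using a(2) b(2) Some unfolding map_le_iff_Some by (intro bexI[of _ c]) auto
    qed
  qed
  from this[OF fin] show ?thesis
    unfolding map_le_iff_Some by blast
qed

lemma ideal_has_lub: "I \<in> ideals K \<Longrightarrow> \<exists>s. is_lub_in UNIV I s"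
  unfolding ideals_def by (auto elim: directed_has_lub)

lemma ideal_lub_embedding:
  assumes K: "\<And>e. e \<in> K \<Longrightarrow> finite (dom e)"
    and I: "I \<in> ideals K" "is_lub_in UNIV I p"
    and J: "J \<in> ideals K" "is_lub_in UNIV J q"
  shows "p \<subseteq>\<^sub>m q \<longleftrightarrow> I \<subseteq> J"
proof
  assume "I \<subseteq> J"
  then show "p \<subseteq>\<^sub>m q"
    using I(2) J(2) unfolding is_lub_in_def by blast
next
  assume pq: "p \<subseteq>\<^sub>m q"
  show "I \<subseteq> J"
  proof
    fix e
    assume e: "e \<in> I"
    then have "e \<in> K"
      using I(1) unfolding ideals_def by blast
    have "e \<subseteq>\<^sub>m p"
      using e I(2) unfolding is_lub_in_def by blast
    then have "e \<subseteq>\<^sub>m q"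
      using pq by (rule map_le_trans)
    moreover have "directed_set J"
      using J(1) unfolding ideals_def by blast
    ultimately obtain a where "a \<in> J" "e \<subseteq>\<^sub>m a"
      using finite_below_directed_lub[OF _ J(2) K[OF \<open>e \<in> K\<close>]] by blast
    then show "e \<in> J"
      using \<open>e \<in> K\<close> J(1) unfolding ideals_def by blast
  qed
qed


section \<open>Dyadic subbases\<close>

text \<open>
  The topology generated by the sets is taken relative to the carrier, so that the
  intersection of the empty family is the whole space.
\<close>

definition dyadic_subbase :: "'a topology \<Rightarrow> (nat \<Rightarrow> bool \<Rightarrow> 'a set) \<Rightarrow> bool" where
  "dyadic_subbase X S \<longleftrightarrow>
     (\<forall>n a. openin X (S n a) \<and> S n a = X interior_of (X closure_of (S n a))) \<and>
     openin X = arbitrary union_of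
       (finite intersection_of (\<lambda>U. \<exists>n a. U = S n a) relative_to topspace X) \<and>
     (\<forall>n. S n True = topspace X - X closure_of (S n False))"

definition cell :: "'a topology \<Rightarrow> (nat \<Rightarrow> bool \<Rightarrow> 'a set) \<Rightarrow> tseq \<Rightarrow> 'a set" where
  "cell X S p = topspace X \<inter> (\<Inter>k\<in>dom p. S k (the (p k)))"

definition closed_cell :: "'a topology \<Rightarrow> (nat \<Rightarrow> bool \<Rightarrow> 'a set) \<Rightarrow> tseq \<Rightarrow> 'a set" where
  "closed_cell X S p = topspace X \<inter> (\<Inter>k\<in>dom p. X closure_of (S k (the (p k))))"

definition proper_dyadic_subbase :: "'a topology \<Rightarrow> (nat \<Rightarrow> bool \<Rightarrow> 'a set) \<Rightarrow> bool" where
  "proper_dyadic_subbase X S \<longleftrightarrow> dyadic_subbase X S \<and>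
     (\<forall>e. finite (dom e) \<longrightarrow> X closure_of (cell X S e) = closed_cell X S e)"

text \<open>
  Only meant for points of the space and for a dyadic subbase \<open>S\<close>, in which the sets
  \<open>S n False\<close> and \<open>S n True\<close> are disjoint.
\<close>

definition code :: "(nat \<Rightarrow> bool \<Rightarrow> 'a set) \<Rightarrow> 'a \<Rightarrow> tseq" where
  "code S x = (\<lambda>n. if x \<in> S n False then Some False
                   else if x \<in> S n True then Some True else None)"

definition codes :: "'a topology \<Rightarrow> (nat \<Rightarrow> bool \<Rightarrow> 'a set) \<Rightarrow> tseq set" where
  "codes X S = code S ` topspace X"

definition up_codes :: "'a topology \<Rightarrow> (nat \<Rightarrow> bool \<Rightarrow> 'a set) \<Rightarrow> tseq set" where
  "up_codes X S = {p. \<exists>x\<in>topspace X. code S x \<subseteq>\<^sub>m p}"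

definition truncations :: "tseq set \<Rightarrow> tseq set" where
  "truncations P = {p |` {..<m} | p m. p \<in> P}"

definition K_S :: "'a topology \<Rightarrow> (nat \<Rightarrow> bool \<Rightarrow> 'a set) \<Rightarrow> tseq set" where
  "K_S X S = truncations (codes X S)"

definition K_hat_S :: "'a topology \<Rightarrow> (nat \<Rightarrow> bool \<Rightarrow> 'a set) \<Rightarrow> tseq set" where
  "K_hat_S X S = truncations (up_codes X S)"

definition D_S :: "'a topology \<Rightarrow> (nat \<Rightarrow> bool \<Rightarrow> 'a set) \<Rightarrow> tseq set" where
  "D_S X S = ideal_completion (K_S X S)"

definition D_hat_S :: "'a topology \<Rightarrow> (nat \<Rightarrow> bool \<Rightarrow> 'a set) \<Rightarrow> tseq set" where
  "D_hat_S X S = ideal_completion (K_hat_S X S)"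

end

theory Submission
  imports Defs
begin

text \<open>
  Let \<open>P\<close> lie between the set of codes and its upward closure, and let \<open>D\<close> be the ideal
  completion of the set of truncations of elements of \<open>P\<close>; both completions in the theorem are
  of this form.

  A sequence in \<open>D\<close> with finite domain is compact, so a noncompact \<open>p\<close> has digits at
  arbitrarily large positions.  A truncation of \<open>p\<close> that ends in such a digit lies below some
  truncation of a \<open>q \<in> P\<close>, which in turn lies below \<open>p\<close>; hence \<open>p\<close> agrees with \<open>q\<close> up to that
  position, blanks included (\<open>infinite_limit_agrees_with_generator\<close>).

  Suppose that \<open>p\<close> is compatible with the code of \<open>x\<close> and that the latter has the digit \<open>a\<close> at
  position \<open>n\<close>.  Regularity and properness give a finite part \<open>e\<close> of the code of \<open>x\<close> whose closed
  cell lies in \<open>S n a\<close> (\<open>closed_cell_neighbourhood\<close>).  Choose \<open>q \<in> P\<close> that agrees with \<open>p\<close> on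
  \<open>dom e\<close> and at \<open>n\<close>, and a point \<open>y\<close> whose code is below \<open>q\<close>.  Then \<open>e\<close> is compatible with the code
  of \<open>y\<close>, which says that \<open>y\<close> is in the closed cell of \<open>e\<close>.  So \<open>y\<close> is in \<open>S n a\<close>, the digit of \<open>q\<close>
  at \<open>n\<close> is \<open>a\<close>, and so is that of \<open>p\<close>.

  For the minimality of the codes it remains to see that they are noncompact, that is, that
  they have infinite domains.  A point whose code had finite domain would be isolated, by the
  Hausdorff property; but an isolated point is on no boundary, so its code is total.
\<close>

section \<open>Ideal completions of sets of finite sequences\<close>

lemma is_lub_UNIV_unique: "is_lub_in UNIV A s \<Longrightarrow> is_lub_in UNIV A t \<Longrightarrow> s = t"
  unfolding is_lub_in_def by (intro map_le_antisym) auto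

lemma is_lub_in_mono: "is_lub_in Q A s \<Longrightarrow> P \<subseteq> Q \<Longrightarrow> s \<in> P \<Longrightarrow> is_lub_in P A s"
  unfolding is_lub_in_def by blast

lemma subset_ideal_completion: "K \<subseteq> ideal_completion K"
proof
  fix e
  assume e: "e \<in> K"
  have "{b \<in> K. b \<subseteq>\<^sub>m e} \<in> ideals K"
    unfolding ideals_def directed_set_def using e by (auto intro: map_le_trans)
  moreover have "is_lub_in UNIV {b \<in> K. b \<subseteq>\<^sub>m e} e"
    unfolding is_lub_in_def using e by auto
  ultimately show "e \<in> ideal_completion K"
    unfolding ideal_completion_def by blast
qed

lemma ideal_completion_directed_lub:
  assumes K: "\<And>e. e \<in> K \<Longrightarrow> finite (dom e)"
    and A: "A \<subseteq> ideal_completion K" "directed_set A" and s: "is_lub_in UNIV A s"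
  shows "s \<in> ideal_completion K"
proof -
  define I where "I = {e \<in> K. \<exists>a\<in>A. e \<subseteq>\<^sub>m a}"
  have lub: "\<exists>J\<in>ideals K. is_lub_in UNIV J a" if "a \<in> A" for a
    using A(1) that unfolding ideal_completion_def by blast
  have dir: "\<exists>c\<in>I. e \<subseteq>\<^sub>m c \<and> f \<subseteq>\<^sub>m c" if ef: "e \<in> I" "f \<in> I" for e f
  proof -
    obtain a b where "a \<in> A" "e \<subseteq>\<^sub>m a" "b \<in> A" "f \<subseteq>\<^sub>m b"
      using ef unfolding I_def by blast
    then obtain c where c: "c \<in> A" "e \<subseteq>\<^sub>m c" "f \<subseteq>\<^sub>m c"
      using A(2) unfolding directed_set_def by (meson map_le_trans)
    obtain J where J: "J \<in> ideals K" "is_lub_in UNIV J c"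
      using lub[OF c(1)] by blast
    then have JK: "J \<subseteq> K" and J_dir: "directed_set J"
      unfolding ideals_def by blast+
    obtain e' f' where "e' \<in> J" "e \<subseteq>\<^sub>m e'" "f' \<in> J" "f \<subseteq>\<^sub>m f'"
      using finite_below_directed_lub[OF J_dir J(2)] K ef c(2,3) unfolding I_def by blast
    then obtain g where "g \<in> J" "e \<subseteq>\<^sub>m g" "f \<subseteq>\<^sub>m g"
      using J_dir unfolding directed_set_def by (meson map_le_trans)
    moreover from \<open>g \<in> J\<close> have "g \<in> I"
      using JK J(2) c(1) unfolding I_def is_lub_in_def by blast
    ultimately show ?thesis
      by blast
  qed
  obtain a where "a \<in> A"
    using A(2) unfolding directed_set_def by blast
  moreover obtain J where "J \<in> ideals K" "is_lub_in UNIV J a"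
    using lub[OF \<open>a \<in> A\<close>] by blast
  ultimately have "I \<noteq> {}"
    unfolding I_def ideals_def directed_set_def is_lub_in_def by blast
  with dir have "I \<in> ideals K"
    unfolding ideals_def directed_set_def by (auto simp: I_def intro: map_le_trans)
  moreover have "is_lub_in UNIV I s"
  proof -
    have "a \<subseteq>\<^sub>m t" if t: "\<forall>e\<in>I. e \<subseteq>\<^sub>m t" and a: "a \<in> A" for a t
    proof -
      obtain J where "J \<in> ideals K" and J: "is_lub_in UNIV J a"
        using lub[OF a] by blast
      then have "J \<subseteq> I"
        using a unfolding I_def ideals_def is_lub_in_def by blast
      then show ?thesis
        using J t unfolding is_lub_in_def by blast
    qed
    moreover have "e \<subseteq>\<^sub>m s" if e: "e \<in> I" for e
    proof -
      obtain a where "a \<in> A" "e \<subseteq>\<^sub>m a"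
        using e unfolding I_def by blast
      moreover from \<open>a \<in> A\<close> have "a \<subseteq>\<^sub>m s"
        using s unfolding is_lub_in_def by blast
      ultimately show ?thesis
        by (blast intro: map_le_trans)
    qed
    ultimately show ?thesis
      using s unfolding is_lub_in_def by blast
  qed
  ultimately show ?thesis
    unfolding ideal_completion_def by blast
qed

lemma compact_elementD:
  "c \<in> compact_elements P \<Longrightarrow> A \<subseteq> P \<Longrightarrow> directed_set A \<Longrightarrow> is_lub_in P A s \<Longrightarrow> c \<subseteq>\<^sub>m s \<Longrightarrow>
    \<exists>a\<in>A. c \<subseteq>\<^sub>m a"
  unfolding compact_elements_def by simp

lemma compact_element_ideal_completion_iff:
  assumes K: "\<And>e. e \<in> K \<Longrightarrow> finite (dom e)" and p: "p \<in> ideal_completion K"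
  shows "p \<in> compact_elements (ideal_completion K) \<longleftrightarrow> finite (dom p)"
proof
  assume cpt: "p \<in> compact_elements (ideal_completion K)"
  obtain I where I: "I \<in> ideals K" "is_lub_in UNIV I p"
    using p unfolding ideal_completion_def by blast
  have IK: "I \<subseteq> K" and dir: "directed_set I"
    using I(1) unfolding ideals_def by blast+
  have lub: "is_lub_in (ideal_completion K) I p"
    using is_lub_in_mono[OF I(2) subset_UNIV p] .
  obtain a where a: "a \<in> I" "p \<subseteq>\<^sub>m a"
    using compact_elementD[OF cpt subset_trans[OF IK subset_ideal_completion] dir lub map_le_refl]
    by blast
  have "finite (dom a)"
    using K IK a(1) by blast
  with map_le_implies_dom_le[OF a(2)] show "finite (dom p)"
    by (rule finite_subset)
next
  assume fin: "finite (dom p)"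
  have "\<exists>a\<in>A. p \<subseteq>\<^sub>m a" if A: "A \<subseteq> ideal_completion K" "directed_set A"
    and s: "is_lub_in (ideal_completion K) A s" "p \<subseteq>\<^sub>m s" for A s
  proof -
    have "\<exists>t. is_lub_in UNIV A t"
      using A(2) by (auto elim: directed_has_lub)
    then obtain t where t: "is_lub_in UNIV A t" ..
    have "t \<in> ideal_completion K"
      using K A t by (rule ideal_completion_directed_lub)
    then have "s \<subseteq>\<^sub>m t"
      using s(1) t unfolding is_lub_in_def by blast
    with s(2) have "p \<subseteq>\<^sub>m t"
      by (rule map_le_trans)
    then show ?thesis
      by (rule finite_below_directed_lub[OF A(2) t fin])
  qed
  then show "p \<in> compact_elements (ideal_completion K)"
    using p unfolding compact_elements_def by simp
qed

lemma truncation_le: "(p :: tseq) |` A \<subseteq>\<^sub>m p"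
  by (simp add: map_le_def)

lemma finite_dom_truncations: "e \<in> truncations P \<Longrightarrow> finite (dom e)"
  unfolding truncations_def by auto

lemma finite_le_truncation:
  assumes "finite (dom e)" "e \<subseteq>\<^sub>m (p :: tseq)"
  obtains m where "\<And>n. m \<le> n \<Longrightarrow> e \<subseteq>\<^sub>m p |` {..<n}"
proof -
  obtain m where "dom e \<subseteq> {..<m}"
    using assms(1) finite_nat_iff_bounded by blast
  then have "e \<subseteq>\<^sub>m p |` {..<n}" if "m \<le> n" for n
    using assms(2) that by (fastforce simp: map_le_def restrict_map_def)
  then show ?thesis
    using that by blast
qed

lemma subset_ideal_completion_truncations: "P \<subseteq> ideal_completion (truncations P)"
proof
  fix p
  assume p: "p \<in> P"
  define I where "I = {e \<in> truncations P. e \<subseteq>\<^sub>m p}"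
  have trunc: "p |` {..<m} \<in> I" for m
    using p truncation_le unfolding I_def truncations_def by blast
  have "\<exists>c\<in>I. e \<subseteq>\<^sub>m c \<and> f \<subseteq>\<^sub>m c" if ef: "e \<in> I" "f \<in> I" for e f
  proof -
    obtain m n where "\<And>k. m \<le> k \<Longrightarrow> e \<subseteq>\<^sub>m p |` {..<k}" "\<And>k. n \<le> k \<Longrightarrow> f \<subseteq>\<^sub>m p |` {..<k}"
      using ef finite_le_truncation finite_dom_truncations unfolding I_def
      by (metis (no_types, lifting) mem_Collect_eq)
    then show ?thesis
      using trunc[of "max m n"] by (meson max.cobounded1 max.cobounded2)
  qed
  moreover have "I \<noteq> {}"
    using trunc by blast
  ultimately have "I \<in> ideals (truncations P)"
    unfolding ideals_def directed_set_def by (auto simp: I_def intro: map_le_trans)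
  moreover have "is_lub_in UNIV I p"
  proof -
    have "p \<subseteq>\<^sub>m t" if "\<forall>e\<in>I. e \<subseteq>\<^sub>m t" for t
      unfolding map_le_iff_Some
    proof (intro allI impI)
      fix k u
      assume "p k = Some u"
      moreover have "p |` {..<Suc k} \<subseteq>\<^sub>m t"
        using that trunc by blast
      ultimately show "t k = Some u"
        unfolding map_le_iff_Some by (simp add: restrict_map_def)
    qed
    then show ?thesis
      unfolding is_lub_in_def I_def by auto
  qed
  ultimately show "p \<in> ideal_completion (truncations P)"
    unfolding ideal_completion_def by blast
qed

text \<open>
  Without the assumption on the domain, \<open>q\<close> could have additional digits at the positions
  beyond the last digit of \<open>p\<close>.
\<close>

lemma infinite_limit_agrees_with_generator:
  assumes p: "p \<in> ideal_completion (truncations P)" and inf: "infinite (dom p)"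
  shows "\<exists>q\<in>P. \<forall>i<m. q i = p i"
proof -
  obtain I where I: "I \<in> ideals (truncations P)" "is_lub_in UNIV I p"
    using p unfolding ideal_completion_def by blast
  obtain k where k: "m \<le> k" "k \<in> dom p"
    using inf unfolding infinite_nat_iff_unbounded_le by blast
  have "finite (dom (p |` {..k}))"
    by simp
  then obtain a where a: "a \<in> I" "p |` {..k} \<subseteq>\<^sub>m a"
    using finite_below_directed_lub[OF _ I(2) _ truncation_le] I(1)
    unfolding ideals_def by blast
  then obtain q j where q: "q \<in> P" "a = q |` {..<j}"
    using I(1) unfolding ideals_def truncations_def by blast
  have ap: "a \<subseteq>\<^sub>m p"
    using a(1) I(2) unfolding is_lub_in_def by blast
  have pa: "a i = Some u" if "i \<le> k" "p i = Some u" for i u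
    using a(2) that unfolding map_le_iff_Some by (simp add: restrict_map_def)
  \<comment> \<open>The truncation of \<open>q\<close> is long enough, since \<open>p\<close> has a digit at \<open>k\<close>.\<close>
  have "k < j"
    using k(2) pa[of k] q(2) by (auto simp: restrict_map_def split: if_splits)
  have "q i = p i" if "i < m" for i
  proof -
    have "a i = q i"
      using that k(1) \<open>k < j\<close> q(2) by (simp add: restrict_map_def)
    moreover have "a i = p i"
      using ap pa[of i] that k(1) unfolding map_le_iff_pointwise
      by (cases "p i") (auto dest: spec[of _ i])
    ultimately show ?thesis
      by simp
  qed
  with q(1) show ?thesis
    by blast
qed

section \<open>Cells of a dyadic subbase\<close>

lemma dyadic_subbase_exterior:
  assumes "dyadic_subbase X S"
  shows "S n (\<not> a) = topspace X - X closure_of (S n a)"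
proof -
  have T: "S n True = topspace X - X closure_of (S n False)"
    and reg: "S n False = X interior_of (X closure_of (S n False))"
    using assms unfolding dyadic_subbase_def by blast+
  show ?thesis
  proof (cases a)
    case True
    have "S n False = topspace X - X closure_of (topspace X - X closure_of (S n False))"
      using reg interior_of_closure_of by metis
    then show ?thesis
      using True T by simp
  qed (simp add: T)
qed

lemma dyadic_subbase_openin: "dyadic_subbase X S \<Longrightarrow> openin X (S n a)"
  unfolding dyadic_subbase_def by (elim conjE) simp

lemma dyadic_subbase_subset_topspace: "dyadic_subbase X S \<Longrightarrow> S n a \<subseteq> topspace X"
  by (intro openin_subset dyadic_subbase_openin)

lemma dyadic_subbase_disjoint:
  assumes "dyadic_subbase X S" "x \<in> S n a"
  shows "x \<notin> S n (\<not> a)"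
  using assms dyadic_subbase_exterior[OF assms(1), of n a]
    closure_of_subset[OF dyadic_subbase_subset_topspace[OF assms(1)]] by blast

lemma code_eq_Some_iff:
  assumes "dyadic_subbase X S"
  shows "code S x n = Some a \<longleftrightarrow> x \<in> S n a"
  using dyadic_subbase_disjoint[OF assms, of x n False] by (cases a) (auto simp: code_def)

lemma in_closure_of_subbase_iff:
  assumes "dyadic_subbase X S" "x \<in> topspace X"
  shows "x \<in> X closure_of (S n a) \<longleftrightarrow> code S x n \<noteq> Some (\<not> a)"
  using dyadic_subbase_exterior[OF assms(1), of n a] assms(2) code_eq_Some_iff[OF assms(1)]
  by blast

lemma in_cell_iff:
  assumes "dyadic_subbase X S" "x \<in> topspace X"
  shows "x \<in> cell X S p \<longleftrightarrow> p \<subseteq>\<^sub>m code S x"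
  unfolding cell_def map_le_iff_Some code_eq_Some_iff[OF assms(1)] using assms(2) by fastforce

lemma in_closed_cell_iff:
  assumes "dyadic_subbase X S" "x \<in> topspace X"
  shows "x \<in> closed_cell X S p \<longleftrightarrow> (\<forall>k a. p k = Some a \<longrightarrow> code S x k \<noteq> Some (\<not> a))"
  unfolding closed_cell_def using assms(2) in_closure_of_subbase_iff[OF assms] by fastforce

lemma cell_neighbourhood:
  assumes S: "dyadic_subbase X S" and U: "openin X U" "x \<in> U"
  obtains e where "finite (dom e)" "e \<subseteq>\<^sub>m code S x" "cell X S e \<subseteq> U"
proof -
  have "(arbitrary union_of
       (finite intersection_of (\<lambda>U. \<exists>n a. U = S n a) relative_to topspace X)) U"
    using S U(1) unfolding dyadic_subbase_def by metis
  then obtain W where W: "(finite intersection_of (\<lambda>U. \<exists>n a. U = S n a) relative_to topspace X) W"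
    "x \<in> W" "W \<subseteq> U"
    using U(2) unfolding union_of_def by blast
  then obtain F where F: "finite F" "F \<subseteq> {U. \<exists>n a. U = S n a}" "W = topspace X \<inter> \<Inter>F"
    unfolding relative_to_def intersection_of_def by blast
  have "F \<subseteq> case_prod S ` UNIV"
    using F(2) by fastforce
  then obtain C where C: "finite C" "F = case_prod S ` C"
    using finite_subset_image[OF F(1), of "case_prod S" UNIV] by metis
  define e where "e = code S x |` (fst ` C)"
  have "finite (dom e)"
    unfolding e_def using C(1) by simp
  moreover have "cell X S e \<subseteq> W"
  proof
    fix y
    assume y: "y \<in> cell X S e"
    then have yX: "y \<in> topspace X"
      unfolding cell_def by blast
    have "y \<in> S n a" if "(n, a) \<in> C" for n a
    proof -
      have "x \<in> S n a"
        using W(2) F(3) C(2) that by fastforce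
      then have "e n = Some a"
        using that code_eq_Some_iff[OF S] unfolding e_def restrict_map_def by force
      then have "code S y n = Some a"
        using y in_cell_iff[OF S yX] unfolding map_le_iff_Some by blast
      then show ?thesis
        using code_eq_Some_iff[OF S] by blast
    qed
    then show "y \<in> W"
      using F(3) C(2) yX by auto
  qed
  moreover have "e \<subseteq>\<^sub>m code S x"
    unfolding e_def by (rule truncation_le)
  ultimately show ?thesis
    using that W(3) by blast
qed

text \<open>This is the only step that needs regularity of the space and properness of the subbase.\<close>

lemma closed_cell_neighbourhood:
  assumes "regular_space X" and S: "proper_dyadic_subbase X S" and U: "openin X U" "x \<in> U"
  obtains e where "finite (dom e)" "e \<subseteq>\<^sub>m code S x" "closed_cell X S e \<subseteq> U"
proof -
  have dy: "dyadic_subbase X S"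
    using S unfolding proper_dyadic_subbase_def by blast
  obtain V C where V: "openin X V" "closedin X C" "x \<in> V" "V \<subseteq> C" "C \<subseteq> U"
    using assms(1) U unfolding neighbourhood_base_of_closedin[symmetric] neighbourhood_base_of
    by metis
  obtain e where e: "finite (dom e)" "e \<subseteq>\<^sub>m code S x" "cell X S e \<subseteq> V"
    using cell_neighbourhood[OF dy V(1,3)] .
  have "X closure_of (cell X S e) \<subseteq> C"
    using closure_of_minimal[OF _ V(2)] e(3) V(4) by blast
  then have "closed_cell X S e \<subseteq> U"
    using S e(1) V(5) unfolding proper_dyadic_subbase_def by auto
  with e show ?thesis
    using that by blast
qed

lemma infinite_dom_code:
  assumes "Hausdorff_space X" and S: "dyadic_subbase X S" and x: "x \<in> topspace X"
  shows "infinite (dom (code S x))"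
proof
  assume fin: "finite (dom (code S x))"
  then have "dom (code S x) \<noteq> UNIV"
    by auto
  then obtain n where n: "code S x n = None"
    by blast
  have "x \<in> X closure_of (S n False)"
    using in_closure_of_subbase_iff[OF S x] n by simp
  moreover have "openin X (cell X S (code S x))"
    unfolding cell_def using fin dyadic_subbase_openin[OF S] openin_topspace
    by (cases "dom (code S x) = {}") (simp_all add: openin_Int openin_INT2)
  moreover have "x \<in> cell X S (code S x)"
    using in_cell_iff[OF S x] by simp
  ultimately obtain y where y: "y \<in> S n False" "y \<in> cell X S (code S x)"
    unfolding in_closure_of by blast
  then have yX: "y \<in> topspace X"
    unfolding cell_def by blast
  \<comment> \<open>Every cell around \<open>x\<close> contains the cell of the whole code of \<open>x\<close>, hence \<open>y\<close>.\<close>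
  have "y \<in> U" if U: "openin X U" "x \<in> U" for U
  proof -
    obtain e where e: "e \<subseteq>\<^sub>m code S x" "cell X S e \<subseteq> U"
      using cell_neighbourhood[OF S U] .
    have "e \<subseteq>\<^sub>m code S y"
      using e(1) y(2) in_cell_iff[OF S yX] map_le_trans by blast
    then show ?thesis
      using e(2) in_cell_iff[OF S yX] by blast
  qed
  then have "x = y"
    using assms(1) x yX unfolding Hausdorff_space_def disjnt_iff by blast
  then show False
    using y(1) n code_eq_Some_iff[OF S, of x n False] by simp
qed

section \<open>Limits compatible with a code\<close>

lemma code_le_infinite_limit:
  assumes reg: "regular_space X" and S: "proper_dyadic_subbase X S" and P: "P \<subseteq> up_codes X S"
    and p: "p \<in> ideal_completion (truncations P)" "infinite (dom p)"
    and comp: "compatible p (code S x)"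
  shows "code S x \<subseteq>\<^sub>m p"
  unfolding map_le_iff_Some
proof (intro allI impI)
  fix n a
  assume na: "code S x n = Some a"
  have dy: "dyadic_subbase X S"
    using S unfolding proper_dyadic_subbase_def by blast
  have open_S: "openin X (S n a)"
    by (rule dyadic_subbase_openin[OF dy])
  have "x \<in> S n a"
    using na code_eq_Some_iff[OF dy] by blast
  with open_S obtain e where e: "finite (dom e)" "e \<subseteq>\<^sub>m code S x" "closed_cell X S e \<subseteq> S n a"
    by (rule closed_cell_neighbourhood[OF reg S])
  have "finite (insert n (dom e))"
    using e(1) by simp
  then obtain m where m: "insert n (dom e) \<subseteq> {..<m}"
    unfolding finite_nat_iff_bounded by (elim exE)
  obtain q where q_P: "q \<in> P" and q_below: "\<forall>i<m. q i = p i"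
    using infinite_limit_agrees_with_generator[OF p, of m] by blast
  have q_eq: "q i = p i" if "i \<in> insert n (dom e)" for i
    using q_below m that by blast
  obtain y where y: "y \<in> topspace X" "code S y \<subseteq>\<^sub>m q"
    using P q_P unfolding up_codes_def by blast
  obtain r where r: "p \<subseteq>\<^sub>m r" "code S x \<subseteq>\<^sub>m r"
    using comp unfolding compatible_def by blast
  have "code S y k \<noteq> Some (\<not> b)" if "e k = Some b" for k b
  proof
    assume "code S y k = Some (\<not> b)"
    then have "q k = Some (\<not> b)"
      using y(2) unfolding map_le_iff_Some by blast
    then have "p k = Some (\<not> b)"
      using q_eq[of k] that by (simp add: domIff)
    then have "r k = Some (\<not> b)"
      using r(1) unfolding map_le_iff_Some by blast
    moreover have "r k = Some b"
      using that e(2) r(2) unfolding map_le_iff_Some by blast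
    ultimately show False
      by simp
  qed
  then have "y \<in> closed_cell X S e"
    using in_closed_cell_iff[OF dy y(1)] by blast
  then have "code S y n = Some a"
    using e(3) code_eq_Some_iff[OF dy] by blast
  then have "q n = Some a"
    using y(2) unfolding map_le_iff_Some by blast
  then show "p n = Some a"
    using q_eq[of n] by simp
qed

theorem theorem6p3:
  fixes X :: "'a topology" and S :: "nat \<Rightarrow> bool \<Rightarrow> 'a set" and D :: "tseq set"
  assumes "topspace X \<noteq> {}"
    and "second_countable X" and "Hausdorff_space X" and "regular_space X"
    and "proper_dyadic_subbase X S"
    and "D = D_S X S \<or> D = D_hat_S X S"
  shows "(\<forall>p\<in>noncompact_elements D. \<forall>x\<in>topspace X.
            compatible p (code S x) \<longrightarrow> code S x \<subseteq>\<^sub>m p) \<and>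
         codes X S \<subseteq> minimal_elements (noncompact_elements D)"
proof -
  have dy: "dyadic_subbase X S"
    using assms(5) unfolding proper_dyadic_subbase_def by blast
  have codes_up: "codes X S \<subseteq> up_codes X S"
    unfolding codes_def up_codes_def by (auto intro: map_le_refl)
  then obtain P where P: "codes X S \<subseteq> P" "P \<subseteq> up_codes X S"
    and D: "D = ideal_completion (truncations P)"
    using assms(6) unfolding D_S_def D_hat_S_def K_S_def K_hat_S_def by blast
  have noncompact_iff: "p \<in> noncompact_elements D \<longleftrightarrow> p \<in> D \<and> infinite (dom p)" for p
    unfolding noncompact_elements_def D
    using compact_element_ideal_completion_iff[of "truncations P" p] finite_dom_truncations
    by blast
  have le: "code S x \<subseteq>\<^sub>m p" if "p \<in> noncompact_elements D" "compatible p (code S x)" for p x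
    using code_le_infinite_limit[OF assms(4,5) P(2)] that noncompact_iff D by blast
  have "code S x \<in> minimal_elements (noncompact_elements D)" if x: "x \<in> topspace X" for x
  proof -
    have "code S x \<in> D"
      using x P(1) subset_ideal_completion_truncations unfolding D codes_def by blast
    then have "code S x \<in> noncompact_elements D"
      using noncompact_iff infinite_dom_code[OF assms(3) dy x] by blast
    moreover have "q = code S x" if "q \<in> noncompact_elements D" "q \<subseteq>\<^sub>m code S x" for q
      using le[of q x] that map_le_antisym unfolding compatible_def by (meson map_le_refl)
    ultimately show ?thesis
      unfolding minimal_elements_def by blast
  qed
  then show ?thesis
    using le unfolding codes_def by blast
qed

end
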